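(* Let $R$ be a commutative Artinian ring with unity. Then each of the graphs $\mathrm{Cl}(R)$ and $\mathrm{Cl}_2(R)$ has finitely many vertices if and only if $R$ is finite.
   Context: $U(R)$ is the set of units, $\mathrm{Id}(R)$ the set of idempotents. The clean graph $\mathrm{Cl}(R)$ has vertex set $\{(e,u): e\in\mathrm{Id}(R), u\in U(R)\}$, two distinct vertices $(e,u),(f,v)$ being adjacent iff $ef=0$ or $uv=1$; $\mathrm{Cl}_2(R)$ is its subgraph induced by the vertices with $e\neq 0$. *)

theory Defs
  imports "HOL-Algebra.Ideal" "Graph_Theory.Pair_Digraph"
    "Graph_Theory.Digraph_Component"
begin

locale artinian_cring = cring R for R (structure) +
  assumes descending_chain_condition:
    "\<And>I :: nat \<Rightarrow> 'a set. \<lbrakk>\<And>n. ideal (I n) R; \<And>n. I (Suc n) \<subseteq> I n\<rbrakk>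
      \<Longrightarrow> \<exists>m. \<forall>n\<ge>m. I n = I m"

definition idempotents :: "('a, 'm) ring_scheme \<Rightarrow> 'a set" where
  "idempotents R = {e \<in> carrier R. e \<otimes>\<^bsub>R\<^esub> e = e}"

text \<open>A simple undirected graph is represented, as usual in the graph library, by a
  loop-free symmetric digraph whose arcs are ordered pairs of vertices
  (see \<open>clean_graph_simple\<close> and \<open>clean_graph2_simple\<close> below).\<close>

definition clean_graph ::
  "('a, 'm) ring_scheme \<Rightarrow> ('a \<times> 'a, ('a \<times> 'a) \<times> ('a \<times> 'a)) pre_digraph" where
  "clean_graph R =
    (let V = idempotents R \<times> Units R in
      with_proj \<lparr> pverts = V,
        parcs = {((e, u), (f, v)) | e u f v.
          (e, u) \<in> V \<and> (f, v) \<in> V \<and> (e, u) \<noteq> (f, v) \<and>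
          (e \<otimes>\<^bsub>R\<^esub> f = \<zero>\<^bsub>R\<^esub> \<or> u \<otimes>\<^bsub>R\<^esub> v = \<one>\<^bsub>R\<^esub>)} \<rparr>)"

definition clean_graph2 ::
  "('a, 'm) ring_scheme \<Rightarrow> ('a \<times> 'a, ('a \<times> 'a) \<times> ('a \<times> 'a)) pre_digraph" where
  "clean_graph2 R =
    clean_graph R \<restriction> {(e, u). (e, u) \<in> verts (clean_graph R) \<and> e \<noteq> \<zero>\<^bsub>R\<^esub>}"

lemma (in cring) clean_graph_simple:
  "loopfree_digraph (clean_graph R)" "nomulti_digraph (clean_graph R)"
  "sym_digraph (clean_graph R)"
proof -
  have comm: "x \<otimes> y = y \<otimes> x" if "x \<in> idempotents R \<union> Units R" "y \<in> idempotents R \<union> Units R" for x y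
    using that by (auto simp: idempotents_def intro: m_comm)
  show "loopfree_digraph (clean_graph R)" "nomulti_digraph (clean_graph R)"
    by (unfold_locales; auto simp: clean_graph_def Let_def with_proj_def arc_to_ends_def)+
  show "sym_digraph (clean_graph R)"
    by unfold_locales
      (auto simp: clean_graph_def Let_def with_proj_def symmetric_def arcs_ends_conv comm
        intro!: symI image_eqI)
qed

lemma (in cring) clean_graph2_simple:
  "loopfree_digraph (clean_graph2 R)" "nomulti_digraph (clean_graph2 R)"
  "sym_digraph (clean_graph2 R)"
proof -
  have comm: "x \<otimes> y = y \<otimes> x" if "x \<in> idempotents R \<union> Units R" "y \<in> idempotents R \<union> Units R" for x y
    using that by (auto simp: idempotents_def intro: m_comm)
  show "loopfree_digraph (clean_graph2 R)" "nomulti_digraph (clean_graph2 R)"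
    by (unfold_locales; auto simp: clean_graph2_def clean_graph_def Let_def with_proj_def arc_to_ends_def)+
  show "sym_digraph (clean_graph2 R)"
    by unfold_locales
      (auto simp: clean_graph2_def clean_graph_def Let_def with_proj_def symmetric_def arcs_ends_conv comm
        intro!: symI image_eqI)
qed

end

theory Submission
  imports Defs
begin

text \<open>
  An Artinian ring is clean: every element is the sum of an idempotent and a unit, so the ring
  is the image of \<open>Id(R) \<times> U(R)\<close> under addition. Indeed, stabilisation of the powers
  of the ideal \<open>(x)\<close> gives \<open>x\<^sup>m = x\<^sup>2\<^sup>m y\<close> with \<open>m \<ge> 1\<close>. Then \<open>e = x\<^sup>m y\<close> is
  an idempotent such that \<open>x\<close> is invertible in \<open>eR\<close> and nilpotent in \<open>(1 - e)R\<close>,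
  whence \<open>x - (1 - e)\<close> is a unit.
\<close>

text \<open>The cofactor is the geometric sum \<open>1 + x + ... + x^(n-1)\<close>, built up by one
  summand per induction step. It inverts \<open>1 - x\<close> wherever \<open>x^n\<close>
  vanishes.\<close>

lemma (in cring) one_minus_dvd_one_minus_pow:
  assumes "x \<in> carrier R"
  shows "\<exists>s\<in>carrier R. (\<one> \<ominus> x) \<otimes> s = \<one> \<ominus> x [^] (n::nat)"
proof (induction n)
  case 0
  show ?case
    using assms by (intro bexI[of _ \<zero>]) (simp_all add: minus_eq r_neg)
next
  case (Suc n)
  then obtain s where s: "s \<in> carrier R" "(\<one> \<ominus> x) \<otimes> s = \<one> \<ominus> x [^] n"
    by blast
  define p where "p = x [^] n"
  have p: "p \<in> carrier R"
    using assms by (simp add: p_def)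
  have "(\<one> \<ominus> x) \<otimes> (s \<oplus> p) = (\<one> \<ominus> x) \<otimes> s \<oplus> (\<one> \<ominus> x) \<otimes> p"
    using assms s(1) p by (simp add: r_distr)
  also have "\<dots> = (\<one> \<ominus> p) \<oplus> (\<one> \<ominus> x) \<otimes> p"
    by (simp add: s(2) p_def)
  also have "\<dots> = \<one> \<ominus> p \<otimes> x"
    using assms p by algebra
  finally show ?case
    using s(1) p by (intro bexI[of _ "s \<oplus> p"]) (simp_all add: p_def)
qed

text \<open>Once the descending chain of ideals \<open>(x^n)\<close> is constant,
  \<open>x^(m+1)\<close> lies in the ideal generated by its own square. The exponent is
  \<open>Suc m\<close> because exponent 0 would make the equation trivial and because a factor
  \<open>x\<close> must later split off the power.\<close>

lemma (in artinian_cring) strongly_pi_regular: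
  assumes "x \<in> carrier R"
  shows "\<exists>m::nat. \<exists>y\<in>carrier R. x [^] Suc m = y \<otimes> (x [^] Suc m \<otimes> x [^] Suc m)"
proof -
  have "PIdl (x [^] Suc n) \<subseteq> PIdl (x [^] n)" for n
  proof (rule cgenideal_minimal)
    show "ideal (PIdl (x [^] n)) R"
      using assms by (simp add: cgenideal_ideal)
    then show "x [^] Suc n \<in> PIdl (x [^] n)"
      using assms by (simp add: cgenideal_self ideal.I_r_closed)
  qed
  then obtain m :: nat where m: "\<forall>n\<ge>m. PIdl (x [^] n) = PIdl (x [^] m)"
    using descending_chain_condition[of "\<lambda>n. PIdl (x [^] n)"] cgenideal_ideal assms by auto
  have "x [^] Suc m \<in> PIdl (x [^] Suc m)"
    using assms by (intro cgenideal_self) simp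
  also have "\<dots> = PIdl (x [^] (Suc m + Suc m))"
    using m[rule_format, of "Suc m"] m[rule_format, of "Suc m + Suc m"] by simp
  also have "x [^] (Suc m + Suc m) = x [^] Suc m \<otimes> x [^] Suc m"
    using assms by (rule nat_pow_mult[symmetric])
  finally show ?thesis
    unfolding cgenideal_def by blast
qed

lemma (in artinian_cring) clean:
  assumes x: "x \<in> carrier R"
  shows "\<exists>f\<in>idempotents R. \<exists>u\<in>Units R. x = f \<oplus> u"
proof -
  obtain m :: nat and y
    where y: "y \<in> carrier R" "x [^] Suc m = y \<otimes> (x [^] Suc m \<otimes> x [^] Suc m)"
    using strongly_pi_regular[OF x] by blast
  obtain s where s: "s \<in> carrier R" "(\<one> \<ominus> x) \<otimes> s = \<one> \<ominus> x [^] Suc m"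
    using one_minus_dvd_one_minus_pow[OF x] by blast
  define z where "z = x [^] m"
  define p where "p = x [^] Suc m"
  define e where "e = p \<otimes> y"
  define u where "u = x \<ominus> (\<one> \<ominus> e)"
  \<comment> \<open>The inverse of \<open>u\<close>, glued from two components. On
    \<open>eR\<close>, \<open>u\<close> acts as \<open>x\<close>, and
    \<open>x z y = p y = e\<close>. On \<open>(1 - e)R\<close>, \<open>u\<close> acts as
    \<open>x - 1\<close>; there \<open>p\<close> vanishes, so \<open>s\<close> inverts
    \<open>1 - x\<close>.\<close>
  define v where "v = z \<otimes> y \<otimes> e \<ominus> s \<otimes> (\<one> \<ominus> e)"
  have z: "z \<in> carrier R" and p: "p \<in> carrier R"
    using x by (simp_all add: z_def p_def del: nat_pow_Suc)
  have e: "e \<in> carrier R"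
    using p y by (simp add: e_def)
  have u: "u \<in> carrier R" and v: "v \<in> carrier R"
    using x y(1) s(1) z e by (simp_all add: u_def v_def)
  have pz: "p = z \<otimes> x"
    by (simp add: p_def z_def)
  \<comment> \<open>Equivalently \<open>p (1 - e) = 0\<close>: this is the nilpotency of
    \<open>x\<close> on \<open>(1 - e)R\<close>.\<close>
  have pe: "p \<otimes> e = p"
  proof -
    have "p \<otimes> e = y \<otimes> (p \<otimes> p)"
      unfolding e_def using p y(1) by algebra
    then show ?thesis
      using y(2) by (simp add: p_def)
  qed
  have ee: "e \<otimes> e = e"
  proof -
    have "e \<otimes> e = (p \<otimes> e) \<otimes> y"
      using p e y(1) by (subst (1) e_def) algebra
    then show ?thesis
      by (simp add: pe e_def[symmetric])
  qed
  have ps: "(\<one> \<ominus> x) \<otimes> s = \<one> \<ominus> p"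
    using s(2) by (simp add: p_def)
  \<comment> \<open>A pure ring identity, valid before \<open>e\<close> is known to be idempotent:
    the multiple of \<open>e e - e\<close> collects the error, and the other terms expose
    \<open>z x\<close> and \<open>(1 - x) s\<close> for rewriting.\<close>
  have "u \<otimes> v = z \<otimes> x \<otimes> y \<otimes> e \<oplus> (\<one> \<ominus> x) \<otimes> s \<otimes> (\<one> \<ominus> e)
      \<oplus> (z \<otimes> y \<oplus> s) \<otimes> (e \<otimes> e \<ominus> e)"
    unfolding u_def v_def using x y(1) z e s(1) by algebra
  also have "\<dots> = p \<otimes> y \<otimes> e \<oplus> (\<one> \<ominus> p) \<otimes> (\<one> \<ominus> e) \<oplus> (z \<otimes> y \<oplus> s) \<otimes> (e \<ominus> e)"
    by (simp only: ps ee pz)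
  also have "\<dots> = (p \<otimes> e) \<otimes> y \<oplus> \<one> \<ominus> p \<ominus> e \<oplus> p \<otimes> e"
    using z y(1) e s(1) p by algebra
  also have "\<dots> = e \<oplus> \<one> \<ominus> p \<ominus> e \<oplus> p"
    by (simp only: pe e_def[symmetric])
  also have "\<dots> = \<one>"
    using e p by algebra
  finally have "u \<otimes> v = \<one>" .
  then have "u \<in> Units R"
    using u v by (auto simp: Units_def m_comm[of v u] intro!: bexI[of _ v])
  moreover have "\<one> \<ominus> e \<in> idempotents R"
  proof -
    have "(\<one> \<ominus> e) \<otimes> (\<one> \<ominus> e) = \<one> \<ominus> e \<ominus> e \<oplus> e \<otimes> e"
      using e by algebra
    also have "\<dots> = \<one> \<ominus> e"
      unfolding ee using e by algebra
    finally show ?thesis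
      using e by (simp add: idempotents_def)
  qed
  moreover have "x = (\<one> \<ominus> e) \<oplus> u"
    unfolding u_def using x e by algebra
  ultimately show ?thesis
    by blast
qed

lemma (in artinian_cring) finite_carrier:
  assumes "finite (idempotents R)" and "finite (Units R)"
  shows "finite (carrier R)"
proof (rule finite_subset)
  show "carrier R \<subseteq> (\<lambda>(f, u). f \<oplus> u) ` (idempotents R \<times> Units R)"
    using clean by fastforce
  show "finite ((\<lambda>(f, u). f \<oplus> u) ` (idempotents R \<times> Units R))"
    using assms by simp
qed

lemma verts_clean_graph: "verts (clean_graph R) = idempotents R \<times> Units R"
  by (simp add: clean_graph_def Let_def)

lemma verts_clean_graph2:
  "verts (clean_graph2 R) = (idempotents R - {\<zero>\<^bsub>R\<^esub>}) \<times> Units R"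
  by (auto simp: clean_graph2_def verts_clean_graph)

theorem theorem4p5:
  fixes R :: "('a, 'm) ring_scheme"
  assumes "artinian_cring R"
  shows "(finite (verts (clean_graph R)) \<longleftrightarrow> finite (carrier R)) \<and>
         (finite (verts (clean_graph2 R)) \<longleftrightarrow> finite (carrier R))"
proof -
  interpret artinian_cring R by fact
  \<comment> \<open>Finiteness of a product passes to its factors only if both are nonempty;
    \<open>1\<close> witnesses this.\<close>
  have one: "\<one>\<^bsub>R\<^esub> \<in> idempotents R" "\<one>\<^bsub>R\<^esub> \<in> Units R"
    by (auto simp: idempotents_def)
  have fin: "finite (idempotents R \<times> Units R)" if "finite (carrier R)"
    using that by (rule_tac finite_cartesian_product)
      (auto intro: finite_subset simp: idempotents_def Units_def)
  have "finite (verts (clean_graph2 R))" if "finite (carrier R)"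
    using fin[OF that] unfolding verts_clean_graph2 by (rule rev_finite_subset) auto
  moreover have "finite (verts (clean_graph R))" if "finite (carrier R)"
    using fin[OF that] by (simp add: verts_clean_graph)
  moreover have "finite (carrier R)" if "finite (verts (clean_graph2 R))"
  \<comment> \<open>In the zero ring there is no nonzero idempotent, so the empty vertex set says
    nothing about the units; but then the carrier is a singleton. Otherwise \<open>1\<close> is a
    nonzero idempotent.\<close>
  proof (cases "\<one>\<^bsub>R\<^esub> = \<zero>\<^bsub>R\<^esub>")
    case True
    then show ?thesis
      using carrier_one_zero by simp
  next
    case False
    then show ?thesis
      using that one
      by (intro finite_carrier) (auto simp: verts_clean_graph2 finite_cartesian_product_iff)
  qed
  moreover have "finite (carrier R)" if "finite (verts (clean_graph R))"
    using that one
    by (intro finite_carrier) (auto simp: verts_clean_graph finite_cartesian_product_iff)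
  ultimately show ?thesis
    by blast
qed

end
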